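(* Let $L$ be a finite-dimensional Lie algebra over an algebraically closed field and let $M$ be a maximal subalgebra of $L$ with a maximal completion $C$ such that $C/k(C)$ is abelian. Then $M$ has an abelian ideal completion in $L$.
   Context: For a nonzero subalgebra $X$ of $L$, the strict core $k(X)$ is the sum of all ideals of $L$ that are proper subalgebras of $X$ (it is $0$ if there are none); it is an ideal of $X$. A subalgebra $C$ is a completion of $M$ if $C\not\subseteq M$ but every proper subalgebra of $C$ that is an ideal of $L$ is contained in $M$; $I(M)$ is the set of completions of $M$, partially ordered by inclusion, and a maximal completion is a maximal element of $I(M)$. An ideal completion is a completion that is an ideal of $L$; an abelian ideal completion is an ideal completion $D$ with $D/k(D)$ abelian. *)

theory Defs
  imports Main "HOL-Computational_Algebra.Polynomial"
begin

definition alg_closed_field :: "'k::field itself \<Rightarrow> bool" where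
  "alg_closed_field _ \<longleftrightarrow> (\<forall>p :: 'k poly. degree p \<noteq> 0 \<longrightarrow> (\<exists>x. poly p x = 0))"

text \<open>A Lie algebra structure on the type 'v over the field 'k, with scalar
  multiplication scale and Lie bracket br.  The Lie algebra L is the whole type.\<close>
definition lie_algebra :: "('k::field \<Rightarrow> 'v::ab_group_add \<Rightarrow> 'v) \<Rightarrow> ('v \<Rightarrow> 'v \<Rightarrow> 'v) \<Rightarrow> bool" where
  "lie_algebra scale br \<longleftrightarrow>
     vector_space scale \<and>
     (\<forall>x y z. br (x + y) z = br x z + br y z) \<and>
     (\<forall>x y z. br x (y + z) = br x y + br x z) \<and>
     (\<forall>a x y. br (scale a x) y = scale a (br x y)) \<and>
     (\<forall>a x y. br x (scale a y) = scale a (br x y)) \<and>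
     (\<forall>x. br x x = 0) \<and>
     (\<forall>x y z. br x (br y z) + br y (br z x) + br z (br x y) = 0)"

definition finite_dim :: "('k::field \<Rightarrow> 'v::ab_group_add \<Rightarrow> 'v) \<Rightarrow> bool" where
  "finite_dim scale \<longleftrightarrow> (\<exists>B. finite B \<and> module.span scale B = UNIV)"

definition lie_subalgebra :: "('k::field \<Rightarrow> 'v::ab_group_add \<Rightarrow> 'v) \<Rightarrow> ('v \<Rightarrow> 'v \<Rightarrow> 'v) \<Rightarrow> 'v set \<Rightarrow> bool" where
  "lie_subalgebra scale br S \<longleftrightarrow> module.subspace scale S \<and> (\<forall>x\<in>S. \<forall>y\<in>S. br x y \<in> S)"

definition lie_ideal :: "('k::field \<Rightarrow> 'v::ab_group_add \<Rightarrow> 'v) \<Rightarrow> ('v \<Rightarrow> 'v \<Rightarrow> 'v) \<Rightarrow> 'v set \<Rightarrow> bool" where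
  "lie_ideal scale br I \<longleftrightarrow> module.subspace scale I \<and> (\<forall>x. \<forall>y\<in>I. br x y \<in> I)"

definition maximal_subalgebra :: "('k::field \<Rightarrow> 'v::ab_group_add \<Rightarrow> 'v) \<Rightarrow> ('v \<Rightarrow> 'v \<Rightarrow> 'v) \<Rightarrow> 'v set \<Rightarrow> bool" where
  "maximal_subalgebra scale br M \<longleftrightarrow> lie_subalgebra scale br M \<and> M \<noteq> UNIV \<and>
     (\<forall>S. lie_subalgebra scale br S \<and> M \<subseteq> S \<longrightarrow> S = M \<or> S = UNIV)"

text \<open>Strict core k(X): the sum (span of the union) of all ideals of L that are proper
  subalgebras of X; it is 0 if there are none.\<close>
definition strict_core :: "('k::field \<Rightarrow> 'v::ab_group_add \<Rightarrow> 'v) \<Rightarrow> ('v \<Rightarrow> 'v \<Rightarrow> 'v) \<Rightarrow> 'v set \<Rightarrow> 'v set" where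
  "strict_core scale br X = module.span scale
     (\<Union>{I. lie_ideal scale br I \<and> lie_subalgebra scale br I \<and> I \<subset> X})"

definition completion :: "('k::field \<Rightarrow> 'v::ab_group_add \<Rightarrow> 'v) \<Rightarrow> ('v \<Rightarrow> 'v \<Rightarrow> 'v) \<Rightarrow> 'v set \<Rightarrow> 'v set \<Rightarrow> bool" where
  "completion scale br M C \<longleftrightarrow> lie_subalgebra scale br C \<and> \<not> C \<subseteq> M \<and>
     (\<forall>I. lie_subalgebra scale br I \<and> I \<subset> C \<and> lie_ideal scale br I \<longrightarrow> I \<subseteq> M)"

definition maximal_completion :: "('k::field \<Rightarrow> 'v::ab_group_add \<Rightarrow> 'v) \<Rightarrow> ('v \<Rightarrow> 'v \<Rightarrow> 'v) \<Rightarrow> 'v set \<Rightarrow> 'v set \<Rightarrow> bool" where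
  "maximal_completion scale br M C \<longleftrightarrow> completion scale br M C \<and>
     \<not> (\<exists>C'. completion scale br M C' \<and> C \<subset> C')"

text \<open>For a subalgebra X and an ideal K of X, X/K is abelian iff [X,X] \<subseteq> K.\<close>
definition quotient_abelian :: "('v \<Rightarrow> 'v \<Rightarrow> 'v) \<Rightarrow> 'v set \<Rightarrow> 'v set \<Rightarrow> bool" where
  "quotient_abelian br X K \<longleftrightarrow> (\<forall>x\<in>X. \<forall>y\<in>X. br x y \<in> K)"

definition abelian_ideal_completion :: "('k::field \<Rightarrow> 'v::ab_group_add \<Rightarrow> 'v) \<Rightarrow> ('v \<Rightarrow> 'v \<Rightarrow> 'v) \<Rightarrow> 'v set \<Rightarrow> 'v set \<Rightarrow> bool" where
  "abelian_ideal_completion scale br M D \<longleftrightarrow> completion scale br M D \<and> lie_ideal scale br D \<and>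
     quotient_abelian br D (strict_core scale br D)"

end

theory Submission
  imports Defs
begin

text \<open>The core \<open>K = k(C)\<close> is an ideal of \<open>L\<close> inside \<open>M\<close>. If \<open>C\<close> is not an ideal of \<open>L\<close>, the abelian
  algebra \<open>C/K\<close> acts on \<open>L/C \<noteq> 0\<close> and has a common eigenvector there, so \<open>C\<close> is a hyperplane in a
  subalgebra \<open>C'\<close>, and \<open>C'/K\<close> is metabelian. By maximality of \<open>C\<close>, \<open>C'\<close> contains an ideal of \<open>L\<close> not
  inside \<open>M\<close>; a minimal such ideal \<open>D\<close> is a completion of \<open>M\<close>. It cannot be perfect, since otherwise
  \<open>D\<close> would lie in the second derived algebra of \<open>C'\<close> and hence in \<open>K \<subseteq> M\<close>. So
  \<open>[D,D]\<close> is an ideal of \<open>L\<close> properly inside \<open>D\<close>, that is, \<open>D/k(D)\<close> is abelian.\<close>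

section \<open>Eigenvectors of an endomorphism modulo a subspace\<close>

locale finite_dim_endomorphism =
  finite_dimensional_vector_space scale Basis + f: Vector_Spaces.linear scale scale f
  for scale :: "'a::field \<Rightarrow> 'b::ab_group_add \<Rightarrow> 'b" and Basis f
begin

text \<open>This is \<open>p(f) w\<close>, evaluated by Horner's scheme with \<open>w\<close> fixed,
  so that only vectors and no sums or products of endomorphisms have to be handled.\<close>

definition poly_orbit :: "'b \<Rightarrow> 'a poly \<Rightarrow> 'b" where
  "poly_orbit w p = fold_coeffs (\<lambda>a u. scale a w + f u) p 0"

lemma poly_orbit_0 [simp]: "poly_orbit w 0 = 0"
  by (simp add: poly_orbit_def)

lemma poly_orbit_pCons:
  "poly_orbit w (pCons a p) = scale a w + f (poly_orbit w p)"
  by (cases "pCons a p = 0") (auto simp: poly_orbit_def)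

lemma poly_orbit_add:
  "poly_orbit w (p + q) = poly_orbit w p + poly_orbit w q"
  by (induction p q rule: poly_induct2)
    (simp_all add: poly_orbit_pCons f.add scale_left_distrib)

lemma poly_orbit_smult:
  "poly_orbit w (smult a p) = scale a (poly_orbit w p)"
  by (induction p) (simp_all add: poly_orbit_pCons f.scale scale_right_distrib)

lemma poly_orbit_linear_factor:
  "poly_orbit w ([:- x, 1:] * q) = f (poly_orbit w q) - scale x (poly_orbit w q)"
  by (simp add: poly_orbit_add poly_orbit_smult poly_orbit_pCons del: smult_minus_left)

lemma poly_orbit_monom:
  "poly_orbit w (monom a n) = scale a ((f ^^ n) w)"
  by (induction n) (simp_all add: monom_0 monom_Suc poly_orbit_pCons f.scale)

lemma poly_orbit_sum:
  "poly_orbit w (\<Sum>i\<in>I. g i) = (\<Sum>i\<in>I. poly_orbit w (g i))"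
  by (induction I rule: infinite_finite_induct) (simp_all add: poly_orbit_add)

lemma poly_orbit_in_invariant_subspace:
  assumes "subspace W" "w \<in> W" "f ` W \<subseteq> W"
  shows "poly_orbit w p \<in> W"
  using assms
  by (induction p) (auto simp: poly_orbit_pCons subspace_0 subspace_add subspace_scale)

text \<open>The iterates of \<open>w\<close> with exponents from 0 to \<open>dimension\<close> are
  one more than the dimension allows, so they satisfy a nontrivial linear relation.\<close>

lemma exists_annihilating_poly:
  obtains p where "p \<noteq> 0" "poly_orbit w p = 0"
proof -
  let ?g = "\<lambda>i. (f ^^ i) w"
  let ?I = "{..dimension}"
  show ?thesis
  proof (cases "inj_on ?g ?I")
    \<comment> \<open>\<open>dependent\<close> speaks of sets and does not see repetitions among the
      iterates; these give their own relation, \<open>X^i - X^j\<close>.\<close>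
    case False
    then obtain i j where ij: "i \<noteq> j" "?g i = ?g j"
      by (auto simp: inj_on_def)
    let ?p = "monom 1 i + monom (- 1) j :: 'a poly"
    have "coeff ?p i \<noteq> 0"
      using ij by simp
    then have "?p \<noteq> 0"
      by (metis coeff_0)
    moreover have "poly_orbit w ?p = 0"
      using ij by (simp add: poly_orbit_add poly_orbit_monom)
    ultimately show ?thesis
      using that by blast
  next
    case True
    then have "card (?g ` ?I) > dimension"
      by (simp add: card_image)
    then have "dependent (?g ` ?I)"
      using independent_card_le_dim[of "?g ` ?I" UNIV] dim_UNIV dimension_def by fastforce
    then obtain u i where u: "i \<in> ?I" "u (?g i) \<noteq> 0" "(\<Sum>v\<in>?g ` ?I. scale (u v) v) = 0"
      by (auto simp: dependent_finite)
    let ?p = "\<Sum>j\<in>?I. monom (u (?g j)) j"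
    have "coeff ?p i = u (?g i)"
      using u(1) by (simp add: coeff_sum)
    then have "?p \<noteq> 0"
      using u(2) by (metis coeff_0)
    moreover have "poly_orbit w ?p = 0"
      using u(3) True by (simp add: poly_orbit_sum poly_orbit_monom sum.reindex)
    ultimately show ?thesis
      using that by blast
  qed
qed

text \<open>Take \<open>p\<close> of least degree with \<open>p(f) w0\<close> in \<open>C\<close>
  and divide out a root \<open>x\<close>. The quotient \<open>q\<close> has smaller degree, so
  \<open>q(f) w0\<close> lies outside \<open>C\<close>, while \<open>f - x\<close> sends it into
  \<open>C\<close>.\<close>

lemma exists_eigenvector_modulo:
  assumes "alg_closed_field TYPE('a)" and "subspace C"
    and W: "subspace W" "f ` W \<subseteq> W" "\<not> W \<subseteq> C"
  obtains x w where "w \<in> W" "w \<notin> C" "f w - scale x w \<in> C"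
proof -
  obtain w0 where w0: "w0 \<in> W" "w0 \<notin> C"
    using W by blast
  let ?P = "\<lambda>p. p \<noteq> 0 \<and> poly_orbit w0 p \<in> C"
  have "\<exists>p. ?P p"
    using exists_annihilating_poly subspace_0[OF \<open>subspace C\<close>] by metis
  then obtain p where p: "p \<noteq> 0" "poly_orbit w0 p \<in> C"
    and least: "\<And>q. ?P q \<Longrightarrow> degree p \<le> degree q"
    using ex_has_least_nat[of ?P _ degree] by blast
  have "degree p \<noteq> 0"
  proof
    assume "degree p = 0"
    then obtain a where a: "p = [:a:]"
      using degree_eq_zeroE by blast
    have "scale a w0 \<in> C"
      using p(2) a by (simp add: poly_orbit_pCons)
    then have "scale (inverse a) (scale a w0) \<in> C"
      using \<open>subspace C\<close> subspace_scale by blast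
    with p(1) a w0 show False
      by simp
  qed
  then obtain x where "poly p x = 0"
    using assms(1) by (auto simp: alg_closed_field_def)
  then obtain q where q: "p = [:- x, 1:] * q"
    by (auto simp: poly_eq_0_iff_dvd)
  then have "q \<noteq> 0"
    using p(1) by auto
  then have "degree p = Suc (degree q)"
    using q degree_mult_eq[of "[:- x, 1:]" q] by simp
  then have "poly_orbit w0 q \<notin> C"
    using least[of q] \<open>q \<noteq> 0\<close> by auto
  moreover have "poly_orbit w0 q \<in> W"
    by (rule poly_orbit_in_invariant_subspace[OF W(1) w0(1) W(2)])
  moreover have "f (poly_orbit w0 q) - scale x (poly_orbit w0 q) \<in> C"
    using p(2) unfolding q poly_orbit_linear_factor .
  ultimately show ?thesis
    using that by blast
qed

end

context finite_dimensional_vector_space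
begin

text \<open>Least dimension gives minimality, since nested subspaces of equal dimension
  coincide.\<close>

lemma exists_minimal_subspace:
  assumes "P U" and "\<And>W. P W \<Longrightarrow> subspace W"
  obtains W where "P W" "\<And>W'. P W' \<Longrightarrow> W' \<subseteq> W \<Longrightarrow> W' = W"
proof -
  obtain W where W: "P W" and least: "\<And>W'. P W' \<Longrightarrow> dim W \<le> dim W'"
    using ex_has_least_nat[of P U dim] assms(1) by blast
  moreover have "W' = W" if "P W'" "W' \<subseteq> W" for W'
    using that least[OF that(1)] assms(2) W subspace_dim_equal by blast
  ultimately show ?thesis
    using that by blast
qed

end

section \<open>Brackets, ideals and strict cores\<close>

locale finite_dim_lie_algebra = finite_dimensional_vector_space scale Basis
  for scale :: "'k::field \<Rightarrow> 'v::ab_group_add \<Rightarrow> 'v" and Basis :: "'v set" +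
  fixes br :: "'v \<Rightarrow> 'v \<Rightarrow> 'v"
  assumes lie: "lie_algebra scale br"
begin

lemma br_add: "br (x + y) z = br x z + br y z" "br x (y + z) = br x y + br x z"
  and br_scale: "br (scale a x) y = scale a (br x y)" "br x (scale a y) = scale a (br x y)"
  and br_self: "br x x = 0"
  and jacobi: "br x (br y z) + br y (br z x) + br z (br x y) = 0"
  using lie by (auto simp: lie_algebra_def)

lemma br_anti: "br x y = - br y x"
  using br_self[of "x + y"] br_self[of x] br_self[of y]
  by (simp add: br_add eq_neg_iff_add_eq_0 add.commute)

lemma linear_br: "Vector_Spaces.linear scale scale (br x)"
  by unfold_locales (simp_all add: br_add br_scale)

lemma endomorphism_br: "finite_dim_endomorphism scale Basis (br x)"
  by (intro finite_dim_endomorphism.intro linear_br) unfold_locales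

lemma br_zero: "br x 0 = 0"
  using br_add(2)[of x 0 0] by simp

lemma br_minus: "br x (- y) = - br x y"
  using br_add(2)[of x y "- y"] by (simp add: br_zero eq_neg_iff_add_eq_0 add.commute)

lemma br_diff: "br x (y - z) = br x y - br x z"
  by (simp only: diff_conv_add_uminus br_add br_minus)

text \<open>The Jacobi identity, read as saying that \<open>br x\<close> is a derivation.\<close>

lemma br_br: "br x (br y z) = br (br x y) z + br y (br x z)"
proof -
  have "br y (br z x) = - br y (br x z)" "br z (br x y) = - br (br x y) z"
    using br_anti[of z x] br_anti[of z "br x y"] by (simp_all add: br_minus)
  then show ?thesis
    using jacobi[of x y z] by (simp add: algebra_simps)
qed

lemma lie_ideal_subspace: "lie_ideal scale br I \<Longrightarrow> subspace I"
  by (simp add: lie_ideal_def)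

lemma lie_ideal_br_left: "lie_ideal scale br I \<Longrightarrow> x \<in> I \<Longrightarrow> br x y \<in> I"
  by (metis br_anti lie_ideal_def subspace_neg)

lemma lie_ideal_br_right: "lie_ideal scale br I \<Longrightarrow> y \<in> I \<Longrightarrow> br x y \<in> I"
  by (simp add: lie_ideal_def)

lemma lie_ideal_imp_subalgebra: "lie_ideal scale br I \<Longrightarrow> lie_subalgebra scale br I"
  by (simp add: lie_ideal_def lie_subalgebra_def)

lemma lie_ideal_span:
  assumes "\<And>x y. y \<in> S \<Longrightarrow> br x y \<in> span S"
  shows "lie_ideal scale br (span S)"
  unfolding lie_ideal_def
proof (intro conjI allI ballI)
  fix x y
  assume "y \<in> span S"
  then show "br x y \<in> span S"
  proof (induction rule: span_induct_alt)
    case base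
    then show ?case
      by (simp add: br_zero span_zero)
  next
    case (step c z y)
    then show ?case
      by (simp add: br_add br_scale span_add span_scale assms)
  qed
qed simp

lemma strict_core_ideal: "lie_ideal scale br (strict_core scale br X)"
  unfolding strict_core_def
  by (rule lie_ideal_span) (auto intro!: span_base simp: lie_ideal_def)

lemma strict_core_subset:
  assumes "subspace X"
  shows "strict_core scale br X \<subseteq> X"
  unfolding strict_core_def using assms by (intro span_minimal) auto

lemma strict_core_subset_of_completion:
  assumes "completion scale br M X" "subspace M"
  shows "strict_core scale br X \<subseteq> M"
  unfolding strict_core_def using assms by (intro span_minimal) (auto simp: completion_def)

text \<open>The derivation \<open>br x\<close> maps a bracket of elements of \<open>D\<close> to a
  sum of two such brackets.\<close>

lemma derived_ideal:
  assumes "lie_ideal scale br D"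
  shows "lie_ideal scale br (span {br x y |x y. x \<in> D \<and> y \<in> D})"
proof (rule lie_ideal_span)
  fix x y
  assume "y \<in> {br x y |x y. x \<in> D \<and> y \<in> D}"
  then obtain u v where uv: "y = br u v" "u \<in> D" "v \<in> D"
    by blast
  have eq: "br x y = br (br x u) v + br u (br x v)"
    unfolding uv(1) by (rule br_br)
  have "br x u \<in> D" "br x v \<in> D"
    using uv assms by (simp_all add: lie_ideal_def)
  then show "br x y \<in> span {br x y |x y. x \<in> D \<and> y \<in> D}"
    unfolding eq using uv by (intro span_add span_base) blast+
qed

text \<open>By bilinearity and \<open>br v v = 0\<close>, only brackets within \<open>C\<close> and
  of \<open>C\<close> with \<open>v\<close> matter. The target \<open>A\<close> is kept separate
  from \<open>C\<close> so that it can also bound the derived algebra of an extension by a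
  line.\<close>

lemma br_span_insert:
  assumes "subspace C" "subspace A"
    and CC: "\<And>c d. c \<in> C \<Longrightarrow> d \<in> C \<Longrightarrow> br c d \<in> A"
    and Cv: "\<And>c. c \<in> C \<Longrightarrow> br c v \<in> A"
    and x: "x \<in> span (insert v C)" and y: "y \<in> span (insert v C)"
  shows "br x y \<in> A"
proof -
  have dec: "\<exists>k c. z = c + scale k v \<and> c \<in> C" if "z \<in> span (insert v C)" for z
    using that assms(1) span_eq_iff span_breakdown_eq[of z v C] by (metis diff_add_cancel)
  obtain j c where c: "x = c + scale j v" "c \<in> C"
    using dec[OF x] by blast
  obtain k d where d: "y = d + scale k v" "d \<in> C"
    using dec[OF y] by blast
  have "br v d \<in> A"
    using Cv[OF d(2)] br_anti[of v d] assms(2) subspace_neg by metis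
  moreover have "br x y = br c d + scale k (br c v) + scale j (br v d)"
    using c d by (simp add: br_add br_scale br_self algebra_simps)
  ultimately show ?thesis
    using CC[OF c(2) d(2)] Cv[OF c(2)] assms(2) by (simp add: subspace_add subspace_scale)
qed

section \<open>Extending a subalgebra by a common eigenvector\<close>

text \<open>Brackets of elements of \<open>C\<close> lie in the ideal \<open>K\<close>, which acts
  as zero on \<open>L/C\<close>. Hence \<open>C\<close> acts there by commuting operators, and a
  minimal nonzero submodule consists of common eigenvectors.\<close>

lemma exists_common_eigenvector_modulo:
  assumes ac: "alg_closed_field TYPE('k)"
    and C: "lie_subalgebra scale br C" "C \<noteq> UNIV"
    and K: "lie_ideal scale br K" "K \<subseteq> C" and ab: "quotient_abelian br C K"
  obtains v \<alpha> where "v \<notin> C" "\<And>c. c \<in> C \<Longrightarrow> br c v - scale (\<alpha> c) v \<in> C"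
proof -
  have sC: "subspace C" and brC: "\<And>x y. x \<in> C \<Longrightarrow> y \<in> C \<Longrightarrow> br x y \<in> C"
    using C(1) by (auto simp: lie_subalgebra_def)
  define P where "P W \<longleftrightarrow> subspace W \<and> C \<subset> W \<and> (\<forall>c\<in>C. br c ` W \<subseteq> W)" for W
  have "P UNIV"
    using C(2) by (auto simp: P_def)
  then obtain W where W: "P W" and minW: "\<And>W'. P W' \<Longrightarrow> W' \<subseteq> W \<Longrightarrow> W' = W"
    using exists_minimal_subspace[of P UNIV] by (auto simp: P_def)
  \<comment> \<open>Schur's lemma: \<open>W/C\<close> is an irreducible \<open>C\<close>-module, so each \<open>c\<close> acts on it as a scalar.\<close>
  have scalar: "\<exists>x. \<forall>w\<in>W. br c w - scale x w \<in> C" if c: "c \<in> C" for c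
  proof -
    have "subspace W" "br c ` W \<subseteq> W" "\<not> W \<subseteq> C"
      using W c by (auto simp: P_def)
    then obtain x w where xw: "w \<in> W" "w \<notin> C" "br c w - scale x w \<in> C"
      using finite_dim_endomorphism.exists_eigenvector_modulo[OF endomorphism_br[of c] ac sC] by blast
    \<comment> \<open>The eigenspace of \<open>c\<close> modulo \<open>C\<close> within
      \<open>W\<close>. It contains \<open>C\<close> and \<open>w\<close> and is stable under
      \<open>C\<close>, so minimality forces it to be all of \<open>W\<close>.\<close>
    define W' where "W' = {w \<in> W. br c w - scale x w \<in> C}"
    have "subspace W'"
    proof (rule subspaceI)
      show "0 \<in> W'"
        using W sC by (simp add: W'_def P_def subspace_0 br_zero)
    next
      fix a b
      assume ab: "a \<in> W'" "b \<in> W'"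
      have "br c (a + b) - scale x (a + b) = (br c a - scale x a) + (br c b - scale x b)"
        by (simp add: br_add scale_right_distrib)
      with ab W sC show "a + b \<in> W'"
        by (simp add: W'_def P_def subspace_add)
    next
      fix k a
      assume a: "a \<in> W'"
      have "br c (scale k a) - scale x (scale k a) = scale k (br c a - scale x a)"
        by (simp add: br_scale scale_right_diff_distrib mult.commute)
      with a W sC show "scale k a \<in> W'"
        by (simp add: W'_def P_def subspace_scale)
    qed
    moreover have "C \<subset> W'"
      using W xw brC[OF c] sC by (auto simp: W'_def P_def subspace_diff subspace_scale)
    moreover have "br d w \<in> W'" if d: "d \<in> C" and w: "w \<in> W'" for d w
    proof -
      have "br (br c d) w \<in> C"
        using ab c d K lie_ideal_br_left by (auto simp: quotient_abelian_def)
      moreover have "br d (br c w - scale x w) \<in> C"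
        using brC d w by (simp add: W'_def)
      moreover have "br c (br d w) - scale x (br d w) = br (br c d) w + br d (br c w - scale x w)"
        by (simp add: br_br[of c d w] br_diff br_scale)
      ultimately show ?thesis
        using d w W sC by (auto simp: W'_def P_def subspace_add)
    qed
    ultimately have "P W'"
      by (auto simp: P_def)
    then have "W' = W"
      using minW by (auto simp: W'_def)
    then show ?thesis
      by (auto simp: W'_def)
  qed
  then obtain \<alpha> where \<alpha>: "\<And>c w. c \<in> C \<Longrightarrow> w \<in> W \<Longrightarrow> br c w - scale (\<alpha> c) w \<in> C"
    by metis
  moreover obtain v where "v \<in> W" "v \<notin> C"
    using W by (auto simp: P_def)
  ultimately show ?thesis
    using that by blast
qed

text \<open>\<open>C'\<close> adjoins an eigenvector to \<open>C\<close>, and \<open>A\<close>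
  bounds its derived algebra. If all weights vanish, \<open>A\<close> is \<open>C\<close>; otherwise
  \<open>A\<close> is \<open>K\<close> plus the line of an eigenvector modulo
  \<open>K\<close>.\<close>

lemma exists_metabelian_extension:
  assumes ac: "alg_closed_field TYPE('k)"
    and C: "lie_subalgebra scale br C" "C \<noteq> UNIV"
    and K: "lie_ideal scale br K" "K \<subseteq> C" and ab: "quotient_abelian br C K"
  obtains C' A where "lie_subalgebra scale br C'" "C \<subset> C'" "subspace A"
    "quotient_abelian br C' A" "quotient_abelian br A K"
proof -
  have sC: "subspace C" and brC: "\<And>x y. x \<in> C \<Longrightarrow> y \<in> C \<Longrightarrow> br x y \<in> C"
    using C(1) by (auto simp: lie_subalgebra_def)
  have sK: "subspace K" and abK: "\<And>x y. x \<in> C \<Longrightarrow> y \<in> C \<Longrightarrow> br x y \<in> K"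
    using K ab by (auto simp: lie_ideal_def quotient_abelian_def)
  have psub: "C \<subset> span (insert u C)" if "u \<notin> C" for u
    using that span_superset[of "insert u C"] by auto
  obtain v \<alpha> where v: "v \<notin> C" and \<alpha>: "\<And>c. c \<in> C \<Longrightarrow> br c v - scale (\<alpha> c) v \<in> C"
    using exists_common_eigenvector_modulo[OF ac C K ab] by blast
  show ?thesis
  proof (cases "\<forall>c\<in>C. \<alpha> c = 0")
    case True
    then have "br x y \<in> C" if "x \<in> span (insert v C)" "y \<in> span (insert v C)" for x y
      using \<alpha> brC br_span_insert[OF sC sC _ _ that] by simp
    then have "lie_subalgebra scale br (span (insert v C))" "quotient_abelian br (span (insert v C)) C"
      using psub[OF v] by (auto simp: lie_subalgebra_def quotient_abelian_def)
    then show ?thesis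
      using that psub[OF v] sC ab by blast
  next
    case False
    then obtain c where c: "c \<in> C" "\<alpha> c \<noteq> 0"
      by blast
    \<comment> \<open>Applying \<open>c\<close> once turns the eigenvector modulo \<open>C\<close> into an eigenvector modulo \<open>K\<close>.\<close>
    define u where "u = br c v"
    define c1 where "c1 = u - scale (\<alpha> c) v"
    have c1: "c1 \<in> C" and u: "u = scale (\<alpha> c) v + c1"
      using \<alpha>[OF c(1)] by (auto simp: c1_def u_def)
    have "u \<notin> C"
    proof
      assume "u \<in> C"
      then have "scale (\<alpha> c) v \<in> C"
        using u c1 sC by (metis add_diff_cancel_right' subspace_diff)
      then have "scale (inverse (\<alpha> c)) (scale (\<alpha> c) v) \<in> C"
        using sC subspace_scale by blast
      with c v show False
        by simp
    qed
    \<comment> \<open>\<open>br c\<close> sends the summand \<open>scale (\<alpha> c) v\<close> of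
      \<open>u\<close> to \<open>scale (\<alpha> c) u\<close>, and sends \<open>c1\<close> into
      \<open>K\<close> because \<open>C/K\<close> is abelian.\<close>
    have cu: "br c u - scale (\<alpha> c) u \<in> K"
    proof -
      have "br c u = scale (\<alpha> c) u + br c c1"
        by (subst (1) u) (simp add: br_add br_scale u_def)
      then show ?thesis
        using abK[OF c(1) c1] by simp
    qed
    have eig: "br d u - scale (\<alpha> d) u \<in> K" if d: "d \<in> C" for d
    proof -
      \<comment> \<open>The defect \<open>e\<close> lies in \<open>C\<close>, so
        \<open>br c e\<close> is in \<open>K\<close>. Commuting \<open>c\<close> past
        \<open>d\<close> shows that \<open>br c e\<close> is also
        \<open>scale (\<alpha> c) e\<close> modulo \<open>K\<close>, and \<open>\<alpha> c\<close>
        is invertible.\<close>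
      define e where "e = br d u - scale (\<alpha> d) u"
      have "e = scale (\<alpha> c) (br d v - scale (\<alpha> d) v) + br d c1 - scale (\<alpha> d) c1"
        by (simp add: e_def u br_add br_scale algebra_simps)
      then have "e \<in> C"
        using \<alpha>[OF d] brC[OF d c1] c1 sC by (simp add: subspace_add subspace_diff subspace_scale)
      then have "br c e \<in> K"
        using abK c by blast
      moreover have "br (br c d) u \<in> K" "br d (br c u - scale (\<alpha> c) u) \<in> K"
        using lie_ideal_br_left lie_ideal_br_right K(1) abK[OF c(1) d] cu by blast+
      moreover have "scale (\<alpha> d) (br c u - scale (\<alpha> c) u) \<in> K"
        using cu sK subspace_scale by blast
      moreover have "scale (\<alpha> c) e = br c e + scale (\<alpha> d) (br c u - scale (\<alpha> c) u)
          - br (br c d) u - br d (br c u - scale (\<alpha> c) u)"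
        by (simp add: e_def br_diff br_scale br_br[of c d u] algebra_simps)
      ultimately have "scale (\<alpha> c) e \<in> K"
        using sK by (simp add: subspace_add subspace_diff)
      then have "scale (inverse (\<alpha> c)) (scale (\<alpha> c) e) \<in> K"
        using sK subspace_scale by blast
      with c show ?thesis
        by (simp add: e_def)
    qed
    let ?A = "span (insert u K)"
    let ?C' = "span (insert u C)"
    have "br d u \<in> ?A" if "d \<in> C" for d
      using eig[OF that] span_breakdown_eq[of "br d u" u K] span_base by blast
    moreover have "K \<subseteq> ?A"
      using span_superset[of "insert u K"] by blast
    ultimately have C'A: "br x y \<in> ?A" if "x \<in> ?C'" "y \<in> ?C'" for x y
      using abK br_span_insert[OF sC subspace_span _ _ that] by blast
    moreover have "?A \<subseteq> ?C'"
      using K(2) by (intro span_mono) auto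
    ultimately have "lie_subalgebra scale br ?C'" "quotient_abelian br ?C' ?A"
      by (auto simp: lie_subalgebra_def quotient_abelian_def)
    moreover have "quotient_abelian br ?A K"
      using br_span_insert[OF sK sK] lie_ideal_br_left[OF K(1)]
      by (auto simp: quotient_abelian_def)
    ultimately show ?thesis
      using that psub[OF \<open>u \<notin> C\<close>] subspace_span by blast
  qed
qed

section \<open>Ideal completions\<close>

text \<open>Choose \<open>D\<close> minimal among the ideals inside \<open>I\<close> that are not
  inside \<open>M\<close>; a smaller ideal escaping \<open>M\<close> would contradict
  minimality.\<close>

lemma exists_minimal_ideal_completion:
  assumes I: "lie_ideal scale br I" "\<not> I \<subseteq> M"
  obtains D where "completion scale br M D" "lie_ideal scale br D" "D \<subseteq> I"
proof -
  define P where "P D \<longleftrightarrow> lie_ideal scale br D \<and> \<not> D \<subseteq> M \<and> D \<subseteq> I" for D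
  have "P I"
    using I by (simp add: P_def)
  then obtain D where D: "P D" and minD: "\<And>D'. P D' \<Longrightarrow> D' \<subseteq> D \<Longrightarrow> D' = D"
    using exists_minimal_subspace[of P I] lie_ideal_subspace by (metis P_def)
  have "completion scale br M D"
    unfolding completion_def
  proof (intro conjI allI impI)
    fix J
    assume J: "lie_subalgebra scale br J \<and> J \<subset> D \<and> lie_ideal scale br J"
    then show "J \<subseteq> M"
      using minD[of J] D by (auto simp: P_def)
  qed (use D lie_ideal_imp_subalgebra in \<open>auto simp: P_def\<close>)
  then show ?thesis
    using that D by (auto simp: P_def)
qed

lemma exists_abelian_ideal_completion:
  assumes ac: "alg_closed_field TYPE('k)"
    and M: "subspace M"
    and C: "maximal_completion scale br M C"
    and ab: "quotient_abelian br C (strict_core scale br C)"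
  shows "\<exists>D. abelian_ideal_completion scale br M D"
proof (cases "lie_ideal scale br C")
  case True
  then show ?thesis
    using C ab by (auto simp: abelian_ideal_completion_def maximal_completion_def)
next
  case False
  let ?K = "strict_core scale br C"
  have compl: "completion scale br M C"
    and max: "\<And>C'. C \<subset> C' \<Longrightarrow> \<not> completion scale br M C'"
    using C by (auto simp: maximal_completion_def)
  have subalg: "lie_subalgebra scale br C" "C \<noteq> UNIV"
    using compl False by (auto simp: completion_def lie_ideal_def lie_subalgebra_def)
  then have "?K \<subseteq> C"
    using strict_core_subset by (simp add: lie_subalgebra_def)
  then obtain C' A where C': "lie_subalgebra scale br C'" "C \<subset> C'" "subspace A"
    "quotient_abelian br C' A" "quotient_abelian br A ?K"
    using exists_metabelian_extension[OF ac subalg strict_core_ideal _ ab] by blast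
  have "\<not> C' \<subseteq> M"
    using compl C'(2) by (auto simp: completion_def)
  \<comment> \<open>As a subalgebra not inside \<open>M\<close>, \<open>C'\<close> can only fail to
    be a completion through a proper ideal that escapes \<open>M\<close>.\<close>
  then obtain I where I: "I \<subset> C'" "lie_ideal scale br I" "\<not> I \<subseteq> M"
    using max[OF C'(2)] C'(1) by (auto simp: completion_def)
  then obtain D where D: "completion scale br M D" "lie_ideal scale br D" "D \<subseteq> I"
    using exists_minimal_ideal_completion by blast
  define D1 where "D1 = span {br x y |x y. x \<in> D \<and> y \<in> D}"
  have D1: "lie_ideal scale br D1"
    using derived_ideal[OF D(2)] by (simp add: D1_def)
  have "D1 \<subseteq> D"
    unfolding D1_def using D(2) by (intro span_minimal) (auto simp: lie_ideal_def)
  have "D1 \<noteq> D"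
  proof
    \<comment> \<open>Perfectness allows deriving twice: \<open>D = [D,D]\<close> lies in
      \<open>A\<close>, and therefore \<open>[D,D]\<close> lies in the strict core of
      \<open>C\<close>.\<close>
    assume perfect: "D1 = D"
    have "D1 \<subseteq> A"
      unfolding D1_def using C'(3,4) D(3) I(1)
      by (intro span_minimal) (auto simp: quotient_abelian_def)
    then have "br x y \<in> ?K" if "x \<in> D" "y \<in> D" for x y
      using that C'(5) perfect by (auto simp: quotient_abelian_def)
    then have "D1 \<subseteq> ?K"
      unfolding D1_def using lie_ideal_subspace[OF strict_core_ideal]
      by (intro span_minimal) auto
    also have "\<dots> \<subseteq> M"
      by (rule strict_core_subset_of_completion[OF compl M])
    finally show False
      using perfect D(1) by (simp add: completion_def)
  qed
  \<comment> \<open>Being a proper subideal, \<open>D1\<close> is one of the summands of the strict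
    core of \<open>D\<close>.\<close>
  then have "D1 \<subseteq> strict_core scale br D"
    unfolding strict_core_def using D1 \<open>D1 \<subseteq> D\<close> lie_ideal_imp_subalgebra
    by (intro subsetI span_base) auto
  moreover have "br x y \<in> D1" if "x \<in> D" "y \<in> D" for x y
    using that by (auto simp: D1_def intro: span_base)
  ultimately have "quotient_abelian br D (strict_core scale br D)"
    by (auto simp: quotient_abelian_def)
  then show ?thesis
    using D by (auto simp: abelian_ideal_completion_def)
qed

end

theorem theorem3p3:
  fixes scale :: "'k::field \<Rightarrow> 'v::ab_group_add \<Rightarrow> 'v"
    and br :: "'v \<Rightarrow> 'v \<Rightarrow> 'v"
    and M C :: "'v set"
  assumes "alg_closed_field TYPE('k)"
    and "lie_algebra scale br"
    and "finite_dim scale"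
    and "maximal_subalgebra scale br M"
    and "maximal_completion scale br M C"
    and "quotient_abelian br C (strict_core scale br C)"
  shows "\<exists>D. abelian_ideal_completion scale br M D"
proof -
  interpret vector_space scale
    using assms(2) by (simp add: lie_algebra_def)
  obtain S where S: "finite S" "span S = UNIV"
    using assms(3) by (auto simp: finite_dim_def)
  \<comment> \<open>The locale asks for a basis, so the finite spanning set is thinned out to an
    independent one.\<close>
  obtain B where B: "B \<subseteq> S" "independent B" "S \<subseteq> span B"
    using maximal_independent_subset[of S] by blast
  then have "span B = UNIV"
    using S(2) span_minimal[OF B(3) subspace_span] by auto
  then interpret finite_dim_lie_algebra scale B br
    using B S(1) assms(2) finite_subset by unfold_locales auto
  show ?thesis
    using exists_abelian_ideal_completion assms(1,4-6)
    by (auto simp: maximal_subalgebra_def lie_subalgebra_def)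
qed

end
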